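(* For every real number $t>1$ there exists a polynomial map $F:\mathbb{C}^4\to\mathbb{C}^3$ whose restriction to the hypersurface $M_t^3$ is an immersion of $M_t^3$ in $\mathbb{C}^3$.
   Context: Let $Q^3:=\{(z_1,z_2,z_3,z_4)\in\mathbb{C}^4: z_1^2+z_2^2+z_3^2+z_4^2=1\}$ be the affine complex quadric, a complex submanifold of $\mathbb{C}^4$ of complex dimension $3$. For $t>1$ let $$M_t^3:=\{(z_1,z_2,z_3,z_4)\in\mathbb{C}^4: |z_1|^2+|z_2|^2+|z_3|^2+|z_4|^2=t\}\cap Q^3,$$ which is a compact strongly pseudoconvex real-analytic hypersurface in $Q^3$ (a real submanifold of real dimension $5$). A polynomial map $\mathbb{C}^4\to\mathbb{C}^3$ is a map whose three components are polynomials with complex coefficients in the complex coordinates $z_1,z_2,z_3,z_4$ (in particular it is holomorphic). An immersion is a smooth map whose differential (between real tangent spaces) is injective at every point. *)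

theory Defs
  imports "HOL-Analysis.Analysis"
begin

text \<open>Smoothness is \<open>C\<^sup>\<infinity>\<close> in the real sense; the set \<open>S\<close> is meant to be open.\<close>

primrec Ck_on :: "nat \<Rightarrow> 'a::real_normed_vector set \<Rightarrow> ('a \<Rightarrow> 'b::real_normed_vector) \<Rightarrow> bool" where
  "Ck_on 0 S f \<longleftrightarrow> continuous_on S f"
| "Ck_on (Suc k) S f \<longleftrightarrow>
     (\<forall>x\<in>S. f differentiable (at x)) \<and>
     (\<forall>v. Ck_on k S (\<lambda>x. frechet_derivative f (at x) v))"

definition smooth_on :: "'a::real_normed_vector set \<Rightarrow> ('a \<Rightarrow> 'b::real_normed_vector) \<Rightarrow> bool" where
  "smooth_on S f \<longleftrightarrow> (\<forall>k. Ck_on k S f)"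

text \<open>The real tangent space at \<open>p\<close> of a smooth submanifold \<open>M\<close> of the ambient vector space,
  as the set of velocities at \<open>p\<close> of smooth curves in \<open>M\<close>.\<close>

definition tangent_space :: "'a::real_normed_vector set \<Rightarrow> 'a \<Rightarrow> 'a set" where
  "tangent_space M p =
     {v. \<exists>(\<gamma> :: real \<Rightarrow> 'a) \<epsilon>. \<epsilon> > 0 \<and> smooth_on {-\<epsilon><..<\<epsilon>} \<gamma> \<and> \<gamma> ` {-\<epsilon><..<\<epsilon>} \<subseteq> M \<and>
           \<gamma> 0 = p \<and> (\<gamma> has_vector_derivative v) (at 0)}"

text \<open>\<open>immersion_on M F\<close>: the restriction of \<open>F\<close> to the submanifold \<open>M\<close> is an immersion, for a
  map \<open>F\<close> that is smooth near \<open>M\<close>. The differential of the restriction at \<open>p\<close> is then the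
  ambient real derivative of \<open>F\<close> at \<open>p\<close>, restricted to the tangent space of \<open>M\<close>.\<close>

definition immersion_on ::
  "'a::real_normed_vector set \<Rightarrow> ('a \<Rightarrow> 'b::real_normed_vector) \<Rightarrow> bool" where
  "immersion_on M F \<longleftrightarrow>
     (\<exists>U. open U \<and> M \<subseteq> U \<and> smooth_on U F) \<and>
     (\<forall>p\<in>M. inj_on (frechet_derivative F (at p)) (tangent_space M p))"

text \<open>Polynomials in the complex coordinates only (no conjugates), written with multi-indices
  \<open>\<alpha>\<close>; contrast \<^const>\<open>real_polynomial_function\<close>.\<close>

definition complex_polynomial :: "(complex ^ 'n \<Rightarrow> complex) \<Rightarrow> bool" where
  "complex_polynomial f \<longleftrightarrow>
     (\<exists>(A :: ('n \<Rightarrow> nat) set) (c :: ('n \<Rightarrow> nat) \<Rightarrow> complex).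
        finite A \<and> (\<forall>z. f z = (\<Sum>\<alpha>\<in>A. c \<alpha> * (\<Prod>i\<in>UNIV. (z $ i) ^ \<alpha> i))))"

definition polynomial_map :: "(complex ^ 'n \<Rightarrow> complex ^ 'm) \<Rightarrow> bool" where
  "polynomial_map F \<longleftrightarrow> (\<forall>j. complex_polynomial (\<lambda>z. F z $ j))"

definition Q3 :: "(complex ^ 4) set" where
  "Q3 = {z. (\<Sum>i\<in>UNIV. (z $ i)\<^sup>2) = 1}"

definition M3 :: "real \<Rightarrow> (complex ^ 4) set" where
  "M3 t = {z. (\<Sum>i\<in>UNIV. (cmod (z $ i))\<^sup>2) = t} \<inter> Q3"

end

theory Submission
  imports Defs "HOL-Computational_Algebra.Polynomial"
begin

text \<open>
  In the linear coordinates \<open>a = z\<^sub>1 + \<i> z\<^sub>2\<close>, \<open>d = z\<^sub>1 - \<i> z\<^sub>2\<close>, \<open>b = z\<^sub>3 + \<i> z\<^sub>4\<close>, \<open>c = z\<^sub>3 - \<i> z\<^sub>4\<close> the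
  quadric is \<open>a d + b c = 1\<close>, a copy of \<open>SL\<^sub>2(\<complex>)\<close>. The immersion has the form \<open>F = (a, b, P)\<close> with
  \<open>P = c d g(b c)\<close> for a polynomial \<open>g\<close> in one variable \<open>w = b c\<close>.

  The tangent vectors of the quadric that are killed by \<open>da\<close> and \<open>db\<close> are the multiples of the vector
  field \<open>X\<close> with \<open>X a = X b = 0\<close>, \<open>X c = a\<close>, \<open>X d = - b\<close>, which has no zero because
  \<open>(a, b) \<noteq> (0, 0)\<close> on the quadric. Hence \<open>F\<close> is a local
  biholomorphism of the quadric wherever \<open>X P \<noteq> 0\<close>. Put \<open>h(w) = w (1 - w) g(w)\<close>. On the quadric
  \<open>a d = 1 - w\<close>, so \<open>a b P = h(w)\<close>; moreover \<open>X w = a b\<close>, and therefore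
  \<open>X P = h'(w)\<close>, first where \<open>a b \<noteq> 0\<close> and then everywhere by continuity.

  On \<open>M3 t\<close> one has \<open>\<bar>w\<bar> = \<bar>z\<^sub>3\<^sup>2 + z\<^sub>4\<^sup>2\<bar> \<le> t\<close>. The problem is thus reduced to one about polynomials in one
  variable: find \<open>h\<close> with \<open>h(0) = h(1) = 0\<close> whose derivative has no zero in the disc of
  radius \<open>t\<close>. The polynomial \<open>h(w) = (1 + (\<zeta> - 1) w)\<^sup>n - 1\<close> has this property when \<open>\<zeta> \<noteq> 1\<close> is an
  \<open>n\<close>-th root of unity close to \<open>1\<close>; this is
  \<open>ex_multiple_of_w_times_1_minus_w_without_critical_points\<close>.

  What remains is to pass between the analytic definitions and this computation: polynomial maps are
  smooth (\<open>polynomial_map_Ck_on\<close>), and velocities of curves in the quadric satisfy the linearized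
  equation (\<open>tangent_space_Q3\<close>).
\<close>

section \<open>Polynomials in several complex variables\<close>

text \<open>The multi-indices may repeat here. Collecting equal ones
  is the only bookkeeping in the closure properties: sums are indexed by a disjoint union, products by a
  Cartesian product.\<close>

lemma complex_polynomial_sum_monomials:
  fixes m :: "'i \<Rightarrow> 'n::finite \<Rightarrow> nat" and c :: "'i \<Rightarrow> complex"
  assumes "finite I"
  shows "complex_polynomial (\<lambda>z. \<Sum>i\<in>I. c i * (\<Prod>k\<in>UNIV. (z $ k) ^ m i k))"
  unfolding complex_polynomial_def
proof (intro exI conjI allI)
  show "finite (m ` I)" using assms by simp
  fix z :: "complex ^ 'n"
  have "(\<Sum>i\<in>I. c i * (\<Prod>k\<in>UNIV. (z $ k) ^ m i k)) =
      (\<Sum>\<alpha>\<in>m ` I. \<Sum>i\<in>{i\<in>I. m i = \<alpha>}. c i * (\<Prod>k\<in>UNIV. (z $ k) ^ m i k))"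
    by (rule sum.image_gen[OF assms])
  also have "\<dots> = (\<Sum>\<alpha>\<in>m ` I. (\<Sum>i\<in>{i\<in>I. m i = \<alpha>}. c i) * (\<Prod>k\<in>UNIV. (z $ k) ^ \<alpha> k))"
    by (intro sum.cong refl) (auto simp: sum_distrib_right intro!: sum.cong)
  finally show "(\<Sum>i\<in>I. c i * (\<Prod>k\<in>UNIV. (z $ k) ^ m i k)) =
      (\<Sum>\<alpha>\<in>m ` I. (\<Sum>i\<in>{i\<in>I. m i = \<alpha>}. c i) * (\<Prod>k\<in>UNIV. (z $ k) ^ \<alpha> k))" .
qed

lemma complex_polynomial_const: "complex_polynomial (\<lambda>z :: complex ^ 'n::finite. a)"
  using complex_polynomial_sum_monomials[of "{()}" "\<lambda>_. a" "\<lambda>_ _. 0"] by simp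

lemma complex_polynomial_nth: "complex_polynomial (\<lambda>z :: complex ^ 'n::finite. z $ k)"
proof -
  have "(\<Prod>l\<in>UNIV. (z $ l) ^ (if l = k then 1 else 0)) = z $ k" for z :: "complex ^ 'n"
    by (simp add: if_distrib[of "\<lambda>e. _ ^ e"] cong: if_cong)
  then show ?thesis
    using complex_polynomial_sum_monomials[of "{()}" "\<lambda>_. 1" "\<lambda>_ l. if l = k then 1 else 0"]
    by simp
qed

lemma complex_polynomial_add:
  fixes f g :: "complex ^ 'n::finite \<Rightarrow> complex"
  assumes "complex_polynomial f" "complex_polynomial g"
  shows "complex_polynomial (\<lambda>z. f z + g z)"
proof -
  obtain A c where A: "finite A" "\<And>z. f z = (\<Sum>\<alpha>\<in>A. c \<alpha> * (\<Prod>i\<in>UNIV. (z $ i) ^ \<alpha> i))"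
    using assms(1) unfolding complex_polynomial_def by auto
  obtain B d where B: "finite B" "\<And>z. g z = (\<Sum>\<alpha>\<in>B. d \<alpha> * (\<Prod>i\<in>UNIV. (z $ i) ^ \<alpha> i))"
    using assms(2) unfolding complex_polynomial_def by auto
  have "f z + g z = (\<Sum>s\<in>A <+> B. case_sum c d s * (\<Prod>i\<in>UNIV. (z $ i) ^ case_sum id id s i))" for z
    using A B by (simp add: sum.Plus)
  then show ?thesis
    using complex_polynomial_sum_monomials[of "A <+> B" "case_sum c d" "case_sum id id"] A(1) B(1)
    by simp
qed

lemma complex_polynomial_mult:
  fixes f g :: "complex ^ 'n::finite \<Rightarrow> complex"
  assumes "complex_polynomial f" "complex_polynomial g"
  shows "complex_polynomial (\<lambda>z. f z * g z)"
proof -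
  obtain A c where A: "finite A" "\<And>z. f z = (\<Sum>\<alpha>\<in>A. c \<alpha> * (\<Prod>i\<in>UNIV. (z $ i) ^ \<alpha> i))"
    using assms(1) unfolding complex_polynomial_def by auto
  obtain B d where B: "finite B" "\<And>z. g z = (\<Sum>\<alpha>\<in>B. d \<alpha> * (\<Prod>i\<in>UNIV. (z $ i) ^ \<alpha> i))"
    using assms(2) unfolding complex_polynomial_def by auto
  have "f z * g z = (\<Sum>s\<in>A \<times> B. (c (fst s) * d (snd s)) *
          (\<Prod>i\<in>UNIV. (z $ i) ^ (fst s i + snd s i)))" for z
    unfolding A B sum_product sum.cartesian_product
    by (intro sum.cong refl) (auto simp: power_add prod.distrib)
  then show ?thesis
    using complex_polynomial_sum_monomials[of "A \<times> B" "\<lambda>s. c (fst s) * d (snd s)"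
        "\<lambda>s i. fst s i + snd s i"] A(1) B(1)
    by simp
qed

lemma complex_polynomial_diff:
  fixes f g :: "complex ^ 'n::finite \<Rightarrow> complex"
  assumes "complex_polynomial f" "complex_polynomial g"
  shows "complex_polynomial (\<lambda>z. f z - g z)"
  using complex_polynomial_add[OF assms(1)
      complex_polynomial_mult[OF complex_polynomial_const[of "-1"] assms(2)]]
  by simp

lemma complex_polynomial_poly:
  fixes f :: "complex ^ 'n::finite \<Rightarrow> complex"
  assumes "complex_polynomial f"
  shows "complex_polynomial (\<lambda>z. poly p (f z))"
  by (induction p)
    (simp_all add: complex_polynomial_const complex_polynomial_add complex_polynomial_mult assms)

lemma complex_polynomial_induct [consumes 1, case_names const nth add mult]:
  fixes f :: "complex ^ 'n::finite \<Rightarrow> complex"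
  assumes "complex_polynomial f"
    and const: "\<And>a. P (\<lambda>z. a)"
    and nth: "\<And>k. P (\<lambda>z. z $ k)"
    and add: "\<And>f g. P f \<Longrightarrow> P g \<Longrightarrow> P (\<lambda>z. f z + g z)"
    and mult: "\<And>f g. P f \<Longrightarrow> P g \<Longrightarrow> P (\<lambda>z. f z * g z)"
  shows "P f"
proof -
  obtain A c where A: "finite A" "\<And>z. f z = (\<Sum>\<alpha>\<in>A. c \<alpha> * (\<Prod>i\<in>UNIV. (z $ i) ^ \<alpha> i))"
    using assms(1) unfolding complex_polynomial_def by auto
  have power: "P (\<lambda>z. (z $ i) ^ e)" for i e
    by (induction e) (simp_all add: const nth mult)
  have "P (\<lambda>z. \<Prod>i\<in>I. (z $ i) ^ \<alpha> i)" if "finite I" for I \<alpha>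
    using that by (induction I) (simp_all add: const mult power)
  then have monom: "P (\<lambda>z. \<Prod>i\<in>UNIV. (z $ i) ^ \<alpha> i)" for \<alpha>
    by simp
  have "P (\<lambda>z. \<Sum>\<alpha>\<in>A. c \<alpha> * (\<Prod>i\<in>UNIV. (z $ i) ^ \<alpha> i))"
    using A(1) by (induction A) (simp_all add: const mult add monom)
  then show ?thesis
    by (simp add: A(2)[abs_def])
qed

section \<open>Smoothness of polynomial maps\<close>

text \<open>The derivative in a fixed direction is again a polynomial in the base point, so that
  differentiation can be iterated within the class.\<close>

lemma complex_polynomial_has_derivative:
  fixes f :: "complex ^ 'n::finite \<Rightarrow> complex"
  assumes "complex_polynomial f"
  shows "\<exists>f'. (\<forall>x. (f has_derivative f' x) (at x)) \<and> (\<forall>v. complex_polynomial (\<lambda>x. f' x v))"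
proof -
  have "complex_polynomial f \<and>
    (\<exists>f'. (\<forall>x. (f has_derivative f' x) (at x)) \<and> (\<forall>v. complex_polynomial (\<lambda>x. f' x v)))"
    using assms
  proof (induction rule: complex_polynomial_induct)
    case (const a)
    show ?case
      by (auto intro!: exI[of _ "\<lambda>x v. 0"] complex_polynomial_const)
  next
    case (nth k)
    have "((\<lambda>z. z $ k) has_derivative (\<lambda>v. v $ k)) (at x)" for x :: "complex ^ 'n"
      by (rule bounded_linear_imp_has_derivative[OF bounded_linear_vec_nth])
    then show ?case
      by (auto intro!: exI[of _ "\<lambda>x v. v $ k"] complex_polynomial_const complex_polynomial_nth)
  next
    case (add f g)
    then obtain f' g' where
      "\<And>x. (f has_derivative f' x) (at x)" "\<And>v. complex_polynomial (\<lambda>x. f' x v)"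
      "\<And>x. (g has_derivative g' x) (at x)" "\<And>v. complex_polynomial (\<lambda>x. g' x v)"
      by blast
    with add show ?case
      by (auto intro!: exI[of _ "\<lambda>x v. f' x v + g' x v"] complex_polynomial_add has_derivative_add)
  next
    case (mult f g)
    then obtain f' g' where
      "\<And>x. (f has_derivative f' x) (at x)" "\<And>v. complex_polynomial (\<lambda>x. f' x v)"
      "\<And>x. (g has_derivative g' x) (at x)" "\<And>v. complex_polynomial (\<lambda>x. g' x v)"
      by blast
    with mult show ?case
      by (auto intro!: exI[of _ "\<lambda>x v. f x * g' x v + f' x v * g x"]
          complex_polynomial_add complex_polynomial_mult has_derivative_mult)
  qed
  then show ?thesis by blast
qed

lemma has_derivative_vec_components:
  fixes F :: "'a::real_normed_vector \<Rightarrow> 'b::euclidean_space ^ 'm::finite"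
  assumes "\<And>j. ((\<lambda>z. F z $ j) has_derivative D j) (at x)"
  shows "(F has_derivative (\<lambda>v. \<chi> j. D j v)) (at x)"
proof -
  have "((\<lambda>z. F z \<bullet> b) has_derivative (\<lambda>v. (\<chi> j. D j v) \<bullet> b)) (at x)" if b: "b \<in> Basis" for b
  proof -
    obtain j u where "b = axis j u" using b by (auto simp: Basis_vec_def)
    then show ?thesis
      using has_derivative_inner_left[OF assms[of j], of u] by (simp add: inner_axis)
  qed
  then show ?thesis
    by (subst has_derivative_componentwise_within) blast
qed

lemma polynomial_map_has_derivative:
  fixes F :: "complex ^ 'n::finite \<Rightarrow> complex ^ 'm::finite"
  assumes "polynomial_map F"
  shows "\<exists>F'. (\<forall>x. (F has_derivative F' x) (at x)) \<and> (\<forall>v. polynomial_map (\<lambda>x. F' x v))"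
proof -
  have "\<forall>j. \<exists>D. (\<forall>x. ((\<lambda>z. F z $ j) has_derivative D x) (at x)) \<and>
      (\<forall>v. complex_polynomial (\<lambda>x. D x v))"
    using assms complex_polynomial_has_derivative unfolding polynomial_map_def by blast
  then obtain D where D: "\<And>j x. ((\<lambda>z. F z $ j) has_derivative D j x) (at x)"
      "\<And>j v. complex_polynomial (\<lambda>x. D j x v)"
    by (auto simp: choice_iff)
  have "(F has_derivative (\<lambda>v. \<chi> j. D j x v)) (at x)" for x
    by (rule has_derivative_vec_components) (rule D(1))
  moreover have "polynomial_map (\<lambda>x. \<chi> j. D j x v)" for v
    using D(2) by (simp add: polynomial_map_def)
  ultimately show ?thesis
    by (intro exI[of _ "\<lambda>x v. \<chi> j. D j x v"]) blast
qed

lemma polynomial_map_Ck_on: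
  fixes F :: "complex ^ 'n::finite \<Rightarrow> complex ^ 'm::finite"
  assumes "polynomial_map F"
  shows "Ck_on k S F"
  using assms
proof (induction k arbitrary: F)
  case 0
  have "F differentiable (at x)" for x
    using polynomial_map_has_derivative[OF 0] by (auto simp: differentiable_def)
  then show ?case
    by (simp add: continuous_at_imp_continuous_on differentiable_imp_continuous_within)
next
  case (Suc k)
  obtain F' where F': "\<And>x. (F has_derivative F' x) (at x)" "\<And>v. polynomial_map (\<lambda>x. F' x v)"
    using polynomial_map_has_derivative[OF Suc.prems] by blast
  have "frechet_derivative F (at x) = F' x" for x
    by (rule frechet_derivative_at[symmetric, OF F'(1)])
  then show ?case
    using F'(1) Suc.IH[OF F'(2)] by (auto simp: differentiable_def)
qed

section \<open>Tangent vectors of the quadric\<close>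

text \<open>Differentiate the constant \<open>\<Sum>i. (\<gamma> s $ i)\<^sup>2 = 1\<close> along a curve \<open>\<gamma>\<close>. The
  resulting equation is complex linear; it cuts out the complex tangent space of the quadric, and at
  the points of \<open>M3 t\<close> the differential of the map constructed below is injective on all of it.\<close>

lemma tangent_space_Q3:
  assumes "M \<subseteq> Q3" and "v \<in> tangent_space M p"
  shows "(\<Sum>i\<in>UNIV. p $ i * v $ i) = 0"
proof -
  obtain \<gamma> :: "real \<Rightarrow> complex ^ 4" and \<epsilon> where \<gamma>: "\<epsilon> > 0" "\<gamma> ` {-\<epsilon><..<\<epsilon>} \<subseteq> M" "\<gamma> 0 = p"
      "(\<gamma> has_vector_derivative v) (at 0)"
    using assms(2) unfolding tangent_space_def by blast
  have comp: "((\<lambda>s. \<gamma> s $ i) has_vector_derivative v $ i) (at 0)" for i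
    using bounded_linear.has_vector_derivative[OF bounded_linear_vec_nth \<gamma>(4)] .
  have "((\<lambda>s. \<Sum>i\<in>UNIV. \<gamma> s $ i * \<gamma> s $ i) has_vector_derivative
      (\<Sum>i\<in>UNIV. \<gamma> 0 $ i * v $ i + v $ i * \<gamma> 0 $ i)) (at 0)"
    by (intro has_vector_derivative_sum has_vector_derivative_mult comp)
  moreover have "((\<lambda>s. \<Sum>i\<in>UNIV. \<gamma> s $ i * \<gamma> s $ i) has_vector_derivative 0) (at 0)"
  proof (rule has_vector_derivative_transform_within_open[of "\<lambda>_. 1" _ _ "{-\<epsilon><..<\<epsilon>}"])
    fix s assume "s \<in> {-\<epsilon><..<\<epsilon>}"
    then have "\<gamma> s \<in> Q3" using \<gamma>(2) assms(1) by blast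
    then show "1 = (\<Sum>i\<in>UNIV. \<gamma> s $ i * \<gamma> s $ i)"
      by (simp add: Q3_def power2_eq_square)
  qed (use \<gamma>(1) in auto)
  ultimately have "(\<Sum>i\<in>UNIV. p $ i * v $ i + v $ i * p $ i) = 0"
    using vector_derivative_unique_at \<gamma>(3) by blast
  then have "2 * (\<Sum>i\<in>UNIV. p $ i * v $ i) = 0"
    by (simp add: sum_distrib_left mult.commute)
  then show ?thesis by simp
qed

section \<open>Polynomials in one variable without critical points in a disc\<close>

lemma ex_root_of_unity_near_1:
  fixes e :: real
  assumes "e > 0"
  shows "\<exists>(n::nat) \<zeta>::complex. n > 0 \<and> \<zeta> ^ n = 1 \<and> \<zeta> \<noteq> 1 \<and> cmod (\<zeta> - 1) < e"
proof -
  have "(\<lambda>n. cis (2 * pi / real n)) \<longlonglongrightarrow> cis 0"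
    unfolding cis_conv_exp by (auto intro!: tendsto_eq_intros real_tendsto_divide_at_top filterlim_real_sequentially)
  then have "(\<lambda>n. cis (2 * pi / real n)) \<longlonglongrightarrow> 1" by simp
  then have "\<forall>\<^sub>F n in sequentially. dist (cis (2 * pi / real n)) 1 < e"
    using assms by (rule tendstoD)
  moreover have "\<forall>\<^sub>F n in sequentially. n \<ge> (3::nat)"
    by (rule eventually_ge_at_top)
  ultimately have "\<forall>\<^sub>F n in sequentially. n \<ge> 3 \<and> dist (cis (2 * pi / real n)) 1 < e"
    by eventually_elim simp
  then obtain n where n: "n \<ge> 3" "dist (cis (2 * pi / real n)) 1 < e"
    by (auto simp: eventually_sequentially)
  \<comment> \<open>For \<open>n \<ge> 3\<close> the angle lies strictly between \<open>0\<close> and \<open>\<pi>\<close>, so the root is not real.\<close>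
  have "2 * pi / real n < pi" using n(1) by (simp add: field_simps)
  then have "sin (2 * pi / real n) > 0" using n(1) by (intro sin_gt_zero) auto
  then have "cis (2 * pi / real n) \<noteq> 1" by (auto simp: complex_eq_iff)
  moreover have "cis (2 * pi / real n) ^ n = 1" using n(1) by (simp add: Complex.DeMoivre)
  ultimately show ?thesis
    using n by (auto simp: dist_norm intro!: exI[of _ n] exI[of _ "cis (2 * pi / real n)"])
qed

text \<open>With \<open>h = (1 + (\<zeta> - 1) w) ^ n - 1\<close> for an \<open>n\<close>-th root of unity \<open>\<zeta>\<close>, the value at \<open>0\<close> is \<open>1 - 1\<close> and the
  value at \<open>1\<close> is \<open>\<zeta> ^ n - 1\<close>, so \<open>h\<close> is divisible by \<open>w (1 - w)\<close>. The only critical point of \<open>h\<close> is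
  \<open>1 / (1 - \<zeta>)\<close>, which leaves every disc about the origin as \<open>\<zeta>\<close> tends to \<open>1\<close>. This \<open>h\<close> is an algebraic
  counterpart of \<open>exp (2 \<pi> \<i> w) - 1\<close>, which vanishes at \<open>0\<close> and \<open>1\<close> and has no critical point at all.\<close>

lemma ex_multiple_of_w_times_1_minus_w_without_critical_points:
  fixes r :: real
  assumes "r > 0"
  shows "\<exists>g :: complex poly. \<forall>w. cmod w \<le> r \<longrightarrow> poly (pderiv ([:0, 1, -1:] * g)) w \<noteq> 0"
proof -
  obtain n and \<zeta> :: complex where \<zeta>: "n > 0" "\<zeta> ^ n = 1" "\<zeta> \<noteq> 1" "cmod (\<zeta> - 1) < 1 / r"
    using ex_root_of_unity_near_1[of "1 / r"] assms by auto
  define h where "h = [:1, \<zeta> - 1:] ^ n - 1"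
  have "poly h 0 = 0" by (simp add: h_def)
  then obtain q where q: "h = [:0, 1:] * q"
    by (auto simp: poly_eq_0_iff_dvd)
  have "poly h 1 = 0" using \<zeta>(2) by (simp add: h_def)
  then have "poly q 1 = 0" by (simp add: q)
  then obtain q' where q': "q = [:-1, 1:] * q'"
    by (auto simp: poly_eq_0_iff_dvd)
  have h: "h = [:0, 1, -1:] * (- q')"
    by (simp add: q q')
  have "poly (pderiv h) w \<noteq> 0" if w: "cmod w \<le> r" for w
  proof -
    have "cmod (w * (\<zeta> - 1)) \<le> r * cmod (\<zeta> - 1)"
      using w by (simp add: norm_mult mult_right_mono)
    also have "\<dots> < 1"
      using \<zeta>(4) assms by (simp add: field_simps)
    finally have "w * (\<zeta> - 1) \<noteq> -1" by auto
    then have "1 + w * (\<zeta> - 1) \<noteq> 0"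
      by (metis add.commute eq_neg_iff_add_eq_0)
    moreover have "poly (pderiv h) w = of_nat n * (1 + w * (\<zeta> - 1)) ^ (n - 1) * (\<zeta> - 1)"
      by (simp add: h_def pderiv_diff pderiv_power pderiv_pCons)
    ultimately show ?thesis using \<zeta>(1,3) by simp
  qed
  then show ?thesis unfolding h by blast
qed

section \<open>The immersion\<close>

theorem theorem1p1:
  fixes t :: real
  assumes "t > 1"
  shows "\<exists>F :: complex ^ 4 \<Rightarrow> complex ^ 3. polynomial_map F \<and> immersion_on (M3 t) F"
proof -
  obtain g :: "complex poly" where
    g: "\<And>w. cmod w \<le> t \<Longrightarrow> poly (pderiv ([:0, 1, -1:] * g)) w \<noteq> 0"
    using ex_multiple_of_w_times_1_minus_w_without_critical_points[of t] assms by auto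
  \<comment> \<open>In these coordinates the equation of \<open>Q3\<close> reads \<open>a d + b c = 1\<close>.\<close>
  define a b c d :: "complex ^ 4 \<Rightarrow> complex"
    where "a = (\<lambda>z. z $ 1 + \<i> * z $ 2)" and "b = (\<lambda>z. z $ 3 + \<i> * z $ 4)"
      and "c = (\<lambda>z. z $ 3 - \<i> * z $ 4)" and "d = (\<lambda>z. z $ 1 - \<i> * z $ 2)"
  note abcd_defs = a_def b_def c_def d_def
  define P where "P = (\<lambda>z. c z * d z * poly g (b z * c z))"
  define F :: "complex ^ 4 \<Rightarrow> complex ^ 3" where "F = (\<lambda>z. vector [a z, b z, P z])"
  have F_nth: "F z $ 1 = a z" "F z $ 2 = b z" "F z $ 3 = P z" for z
    by (simp_all add: F_def)
  have poly_abcd: "complex_polynomial a" "complex_polynomial b" "complex_polynomial c"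
      "complex_polynomial d"
    unfolding abcd_defs
    by (intro complex_polynomial_add complex_polynomial_diff complex_polynomial_mult
        complex_polynomial_const complex_polynomial_nth)+
  then have "complex_polynomial P"
    unfolding P_def by (intro complex_polynomial_mult complex_polynomial_poly)
  with poly_abcd have polyF: "polynomial_map F"
    unfolding polynomial_map_def by (simp add: forall_3 F_nth)

  have lin: "(a has_derivative a) (at p)" "(b has_derivative b) (at p)"
      "(c has_derivative c) (at p)" "(d has_derivative d) (at p)" for p
    unfolding abcd_defs
    by (auto intro!: derivative_eq_intros bounded_linear_imp_has_derivative[OF bounded_linear_vec_nth])
  define dP where "dP = (\<lambda>p v. (c v * d p + c p * d v) * poly g (b p * c p)
      + c p * d p * (poly (pderiv g) (b p * c p) * (b v * c p + b p * c v)))"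
  have P': "(P has_derivative dP p) (at p)" for p
  proof -
    have "((\<lambda>z. poly g (b z * c z)) has_derivative
        (\<lambda>v. poly (pderiv g) (b p * c p) * (b p * c v + b v * c p))) (at p)"
      by (rule has_derivative_compose[OF has_derivative_mult[OF lin(2,3)]
            poly_DERIV[unfolded has_field_derivative_def]])
    from has_derivative_mult[OF has_derivative_mult[OF lin(3,4)] this] show ?thesis
      unfolding P_def by (rule has_derivative_eq_rhs) (simp add: dP_def fun_eq_iff algebra_simps)
  qed
  have F': "(F has_derivative (\<lambda>v. vector [a v, b v, dP p v])) (at p)" for p
  proof -
    have "((\<lambda>z. F z $ j) has_derivative (\<lambda>v. vector [a v, b v, dP p v] $ j)) (at p)" for j :: 3
      using exhaust_3[of j] lin P' by (auto simp: F_nth)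
    then have "(F has_derivative (\<lambda>v. \<chi> j. vector [a v, b v, dP p v] $ j)) (at p)"
      by (rule has_derivative_vec_components)
    then show ?thesis by simp
  qed
  have kernel: "v = 0" if p: "p \<in> M3 t" and tangent: "(\<Sum>i\<in>UNIV. p $ i * v $ i) = 0"
    and a: "a v = 0" and b: "b v = 0" and dP: "dP p v = 0" for p v
  proof -
    have ad_bc: "a p * d p + b p * c p = 1"
    proof -
      have "a p * d p + b p * c p = (\<Sum>i\<in>UNIV. (p $ i)\<^sup>2)"
        by (simp add: abcd_defs sum_4 power2_eq_square algebra_simps)
      then show ?thesis using p by (simp add: M3_def Q3_def)
    qed
    have tan: "a p * d v + b p * c v = 0"
    proof -
      have "a p * d v + d p * a v + b p * c v + c p * b v = 2 * (\<Sum>i\<in>UNIV. p $ i * v $ i)"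
        by (simp add: abcd_defs sum_4 algebra_simps)
      then show ?thesis using tangent a b by simp
    qed
    have small: "cmod (b p * c p) \<le> t"
    proof -
      have "b p * c p = (p $ 3)\<^sup>2 + (p $ 4)\<^sup>2"
        by (simp add: abcd_defs power2_eq_square algebra_simps)
      then have "cmod (b p * c p) \<le> (cmod (p $ 3))\<^sup>2 + (cmod (p $ 4))\<^sup>2"
        by (metis norm_power norm_triangle_ineq)
      also have "\<dots> \<le> (\<Sum>i\<in>UNIV. (cmod (p $ i))\<^sup>2)"
        by (simp add: sum_4)
      finally show ?thesis using p by (simp add: M3_def)
    qed
    \<comment> \<open>Given \<open>a v = 0\<close> and \<open>b v = 0\<close>, tangency leaves only the multiples \<open>(c v, d v) = s (a p, - b p)\<close>,
      because \<open>(a p, b p)\<close> is not zero; the equation \<open>a p * d p + b p * c p = 1\<close> gives this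
      formula for the multiplier.\<close>
    define s where "s = d p * c v - c p * d v"
    have cv: "c v = a p * s"
    proof -
      have "a p * s = (a p * d p + b p * c p) * c v - c p * (a p * d v + b p * c v)"
        by (simp add: s_def algebra_simps)
      then show ?thesis by (simp add: ad_bc tan)
    qed
    have dv: "d v = - (b p * s)"
    proof -
      have "- (b p * s) = (a p * d p + b p * c p) * d v - d p * (a p * d v + b p * c v)"
        by (simp add: s_def algebra_simps)
      then show ?thesis by (simp add: ad_bc tan)
    qed
    define w where "w = b p * c p"
    have ad: "a p * d p = 1 - w" using ad_bc by (simp add: w_def algebra_simps)
    have "dP p v = s * ((a p * d p - w) * poly g w + w * (a p * d p) * poly (pderiv g) w)"
      unfolding dP_def b cv dv w_def[symmetric] by (simp add: w_def algebra_simps)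
    also have "\<dots> = s * poly (pderiv ([:0, 1, -1:] * g)) w"
      unfolding ad pderiv_mult by (simp add: pderiv_pCons algebra_simps)
    finally have "s = 0"
      using dP g[of w] small by (simp add: w_def)
    then have "c v = 0" "d v = 0" by (simp_all add: cv dv)
    then have "v $ 1 = 0 \<and> v $ 2 = 0 \<and> v $ 3 = 0 \<and> v $ 4 = 0"
      using a b by (auto simp: abcd_defs algebra_simps)
    then show ?thesis by (simp add: vec_eq_iff forall_4)
  qed
  \<comment> \<open>The set of velocities of curves in \<open>M3 t\<close> lies in the complex tangent space of \<open>Q3\<close>, which is
    closed under differences and contains no kernel vector of the linear map \<open>dF\<close> except \<open>0\<close>.\<close>
  have "inj_on (frechet_derivative F (at p)) (tangent_space (M3 t) p)" if p: "p \<in> M3 t" for p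
  proof (rule inj_onI)
    fix u v assume u: "u \<in> tangent_space (M3 t) p" and v: "v \<in> tangent_space (M3 t) p"
      and eq: "frechet_derivative F (at p) u = frechet_derivative F (at p) v"
    let ?L = "\<lambda>v. vector [a v, b v, dP p v] :: complex ^ 3"
    have L: "frechet_derivative F (at p) = ?L"
      using frechet_derivative_at[OF F'[of p]] by simp
    have "linear ?L" using F' by (rule has_derivative_linear)
    then have "?L (u - v) = 0"
      using eq linear_diff[of ?L u v] by (simp add: L)
    then have "a (u - v) = 0 \<and> b (u - v) = 0 \<and> dP p (u - v) = 0"
      by (simp add: vec_eq_iff forall_3)
    moreover have "M3 t \<subseteq> Q3" by (simp add: M3_def)
    then have "(\<Sum>i\<in>UNIV. p $ i * (u - v) $ i) = 0"
      using tangent_space_Q3 u v by (simp add: right_diff_distrib sum_subtractf)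
    ultimately have "u - v = 0" using kernel[OF p] by blast
    then show "u = v" by simp
  qed
  moreover have "smooth_on UNIV F"
    unfolding smooth_on_def using polynomial_map_Ck_on[OF polyF] by blast
  ultimately have "immersion_on (M3 t) F"
    unfolding immersion_on_def by blast
  with polyF show ?thesis by blast
qed

end
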